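(* Let $X$ be a real (pre)-ordered Banach space, (pre)-ordered by a closed generating, not necessarily proper, cone $X^{+}$, and let $\Omega$ be a topological space. Suppose that $\alpha>0$. If $X$ is approximately $\alpha$-conormal, then so are $C_{b}(\Omega,X)$, $C_{0}(\Omega,X)$, and $C_{c}(\Omega,X)$. If $C_{b}(\Omega,X)\neq\{0\}$ and $C_{b}(\Omega,X)$ is approximately $\alpha$-conormal, then $X$ is approximately $\alpha$-conormal. If $C_{0}(\Omega,X)\neq\{0\}$ and $C_{0}(\Omega,X)$ is approximately $\alpha$-conormal, then $X$ is approximately $\alpha$-conormal. If $C_{c}(\Omega,X)\neq\{0\}$ and $C_{c}(\Omega,X)$ is approximately $\alpha$-conormal, then $X$ is approximately $\alpha$-conormal.
   Context: A subset $C$ of a real vector space is a cone if $C+C\subseteq C$ and $\lambda C\subseteq C$ for all $\lambda\geq 0$; it is proper if $C\cap(-C)=\{0\}$ (not assumed here); the cone $X^+$ is generating if $X=X^{+}-X^{+}$. For $\alpha>0$, a real normed space $Z$ (pre)-ordered by a closed, not necessarily proper, cone $Z^+$ is $\alpha$-conormal if, for each $z\in Z$, there exist $z^{+},z^{-}\in Z^{+}$ such that $z=z^{+}-z^{-}$ and $\|z^{+}\|\leq\alpha\|z\|$; it is approximately $\alpha$-conormal if it is $(\alpha+\varepsilon)$-conormal for all $\varepsilon>0$ (either property forces $Z^+$ to be generating). For a topological space $\Omega$ (no further assumptions), $C_b(\Omega,X)$, $C_0(\Omega,X)$, $C_c(\Omega,X)$ denote the continuous $X$-valued functions on $\Omega$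 that are, respectively, bounded, vanishing at infinity (i.e. $\{\omega:\|f(\omega)\|\geq\varepsilon\}$ is compact for every $\varepsilon>0$), and compactly supported (the support being the closure of $\{\omega:f(\omega)\neq0\}$). They are normed by $\|f\|_\infty=\sup_{\omega\in\Omega}\|f(\omega)\|$ and (pre)-ordered by the closed cones $C_b(\Omega,X^+)$, $C_0(\Omega,X^+)$, $C_c(\Omega,X^+)$ of functions in these spaces taking values in $X^+$. *)

theory Defs
  imports "HOL-Analysis.Analysis"
begin

(* The space Z is a linear subspace of an ambient normed space, with the induced norm, and Zp is
   its positive cone. This lets C_0 and C_c be treated as subspaces of C_b. *)
definition conormal :: "real \<Rightarrow> 'z::real_normed_vector set \<Rightarrow> 'z set \<Rightarrow> bool" where
  "conormal \<alpha> Z Zp \<longleftrightarrow>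
    (\<forall>z\<in>Z. \<exists>zp\<in>Zp. \<exists>zn\<in>Zp. z = zp - zn \<and> norm zp \<le> \<alpha> * norm z)"

definition approx_conormal :: "real \<Rightarrow> 'z::real_normed_vector set \<Rightarrow> 'z set \<Rightarrow> bool" where
  "approx_conormal \<alpha> Z Zp \<longleftrightarrow> (\<forall>\<epsilon>>0. conormal (\<alpha> + \<epsilon>) Z Zp)"

definition generating :: "'z::real_vector set \<Rightarrow> bool" where
  "generating P \<longleftrightarrow> UNIV = {p - q | p q. p \<in> P \<and> q \<in> P}"

(* The library type of bounded continuous functions, whose norm is the supremum norm, is C_b.
   The lemmas vanishing_in_bcontfun and compact_support_in_bcontfun below show that restricting
   to this type loses no function of C_0 or C_c. *)
abbreviation Cb :: "('b::topological_space \<Rightarrow>\<^sub>C 'a::real_normed_vector) set" where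
  "Cb \<equiv> UNIV"

definition C0 :: "('b::topological_space \<Rightarrow>\<^sub>C 'a::real_normed_vector) set" where
  "C0 = {f. \<forall>\<epsilon>>0. compact {\<omega>. norm (apply_bcontfun f \<omega>) \<ge> \<epsilon>}}"

definition Cc :: "('b::topological_space \<Rightarrow>\<^sub>C 'a::real_normed_vector) set" where
  "Cc = {f. compact (closure {\<omega>. apply_bcontfun f \<omega> \<noteq> 0})}"

definition pos_part :: "('b::topological_space \<Rightarrow>\<^sub>C 'a::real_normed_vector) set \<Rightarrow> 'a set
    \<Rightarrow> ('b \<Rightarrow>\<^sub>C 'a) set" where
  "pos_part Z P = {f \<in> Z. \<forall>\<omega>. apply_bcontfun f \<omega> \<in> P}"

lemma vanishing_in_bcontfun:
  fixes f :: "'b::topological_space \<Rightarrow> 'a::real_normed_vector"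
  assumes "continuous_on UNIV f" and "\<forall>\<epsilon>>0. compact {\<omega>. norm (f \<omega>) \<ge> \<epsilon>}"
  shows "f \<in> bcontfun"
proof -
  let ?K = "{\<omega>. norm (f \<omega>) \<ge> 1}"
  have "compact ?K" using assms(2) by simp
  then have "bounded (f ` ?K)"
    using assms(1) by (meson compact_continuous_image compact_imp_bounded continuous_on_subset subset_UNIV)
  then obtain B where B: "\<And>\<omega>. \<omega> \<in> ?K \<Longrightarrow> norm (f \<omega>) \<le> B"
    by (auto simp: bounded_iff)
  have "norm (f \<omega>) \<le> max B 1" for \<omega>
    using B[of \<omega>] by fastforce
  then show ?thesis using assms(1) by (rule bcontfun_normI[rotated])
qed

lemma compact_support_in_bcontfun:
  fixes f :: "'b::topological_space \<Rightarrow> 'a::real_normed_vector"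
  assumes "continuous_on UNIV f" and "compact (closure {\<omega>. f \<omega> \<noteq> 0})"
  shows "f \<in> bcontfun"
proof -
  let ?K = "closure {\<omega>. f \<omega> \<noteq> 0}"
  have "bounded (f ` ?K)"
    using assms by (meson compact_continuous_image compact_imp_bounded continuous_on_subset subset_UNIV)
  then obtain B where B: "\<And>\<omega>. \<omega> \<in> ?K \<Longrightarrow> norm (f \<omega>) \<le> B"
    by (auto simp: bounded_iff)
  have "norm (f \<omega>) \<le> max B 0" for \<omega>
    using B[of \<omega>] closure_subset[of "{\<omega>. f \<omega> \<noteq> 0}"] by (cases "f \<omega> = 0") fastforce+
  then show ?thesis using assms(1) by (rule bcontfun_normI[rotated])
qed

lemma closed_superlevel:
  fixes f :: "'b::topological_space \<Rightarrow>\<^sub>C 'a::real_normed_vector"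
  shows "closed {\<omega>. norm (apply_bcontfun f \<omega>) \<ge> c}"
  by (intro closed_Collect_le continuous_intros) auto

lemma subspace_C0: "subspace (C0 :: ('b::topological_space \<Rightarrow>\<^sub>C 'a::real_normed_vector) set)"
proof (rule subspaceI)
  show "0 \<in> (C0 :: ('b \<Rightarrow>\<^sub>C 'a) set)" by (simp add: C0_def)
next
  fix f g :: "'b \<Rightarrow>\<^sub>C 'a" assume fg: "f \<in> C0" "g \<in> C0"
  show "f + g \<in> C0" unfolding C0_def
  proof (safe)
    fix e :: real assume "e > 0"
    let ?S = "\<lambda>h c. {\<omega>. norm (apply_bcontfun h \<omega>) \<ge> c}"
    have "compact (?S f (e/2) \<union> ?S g (e/2))"
      using fg half_gt_zero[OF \<open>e > 0\<close>]
      by (intro compact_Un) (simp_all only: C0_def mem_Collect_eq)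
    moreover have "?S (f + g) e \<subseteq> ?S f (e/2) \<union> ?S g (e/2)"
    proof
      fix w assume "w \<in> ?S (f + g) e"
      then show "w \<in> ?S f (e/2) \<union> ?S g (e/2)"
        using norm_triangle_ineq[of "apply_bcontfun f w" "apply_bcontfun g w"] by auto
    qed
    ultimately show "compact (?S (f + g) e)"
      by (metis closed_superlevel closed_Int_compact inf.absorb1)
  qed
next
  fix c :: real and f :: "'b \<Rightarrow>\<^sub>C 'a" assume f: "f \<in> C0"
  show "c *\<^sub>R f \<in> C0"
  proof (cases "c = 0")
    case True then show ?thesis by (simp add: C0_def)
  next
    case False
    then have "(e \<le> \<bar>c\<bar> * r) = (e / \<bar>c\<bar> \<le> r)" for e r :: real
      by (simp add: field_simps)
    with False f show ?thesis by (simp add: C0_def)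
  qed
qed

lemma subspace_Cc: "subspace (Cc :: ('b::topological_space \<Rightarrow>\<^sub>C 'a::real_normed_vector) set)"
proof -
  have sub: "f \<in> Cc" if "compact K" "closed K" "{\<omega>. apply_bcontfun f \<omega> \<noteq> 0} \<subseteq> K"
    for f :: "'b \<Rightarrow>\<^sub>C 'a" and K
    using that unfolding Cc_def
    by (metis (mono_tags, lifting) closed_Int_compact closed_closure closure_minimal inf.absorb1 mem_Collect_eq)
  show ?thesis
  proof (rule subspaceI)
    show "0 \<in> (Cc :: ('b \<Rightarrow>\<^sub>C 'a) set)" by (simp add: Cc_def)
  next
    fix f g :: "'b \<Rightarrow>\<^sub>C 'a" assume "f \<in> Cc" "g \<in> Cc"
    have "{\<omega>. apply_bcontfun (f + g) \<omega> \<noteq> 0} \<subseteq>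
        {\<omega>. apply_bcontfun f \<omega> \<noteq> 0} \<union> {\<omega>. apply_bcontfun g \<omega> \<noteq> 0}"
      by auto
    then have "{\<omega>. apply_bcontfun (f + g) \<omega> \<noteq> 0} \<subseteq>
        closure {\<omega>. apply_bcontfun f \<omega> \<noteq> 0} \<union> closure {\<omega>. apply_bcontfun g \<omega> \<noteq> 0}"
      by (meson Un_mono closure_subset subset_trans)
    then show "f + g \<in> Cc"
      using \<open>f \<in> Cc\<close> \<open>g \<in> Cc\<close>
      by (intro sub[OF compact_Un closed_Un, OF _ _ closed_closure closed_closure])
        (simp_all only: Cc_def mem_Collect_eq)
  next
    fix c :: real and f :: "'b \<Rightarrow>\<^sub>C 'a" assume "f \<in> Cc"
    then show "c *\<^sub>R f \<in> Cc"
      using closure_subset[of "{\<omega>. apply_bcontfun f \<omega> \<noteq> 0}"]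
      by (intro sub[of "closure {\<omega>. apply_bcontfun f \<omega> \<noteq> 0}"]) (auto simp: Cc_def)
  qed
qed

lemma convex_cone_pos_part:
  assumes "subspace Z" "convex_cone P"
  shows "convex_cone (pos_part Z P)"
  using assms by (auto simp: convex_cone_iff pos_part_def subspace_def)

lemma closedin_pos_part:
  fixes P :: "'a::real_normed_vector set" and Z :: "('b::topological_space \<Rightarrow>\<^sub>C 'a) set"
  assumes "closed P"
  shows "closedin (top_of_set Z) (pos_part Z P)"
proof -
  have "closed {f :: 'b \<Rightarrow>\<^sub>C 'a. \<forall>\<omega>. apply_bcontfun f \<omega> \<in> P}"
    unfolding closed_sequential_limits
  proof safe
    fix f :: "nat \<Rightarrow> 'b \<Rightarrow>\<^sub>C 'a" and l \<omega>
    assume seq: "\<forall>n. f n \<in> {f. \<forall>\<omega>. apply_bcontfun f \<omega> \<in> P}" and lim: "f \<longlonglongrightarrow> l"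
    have "(\<lambda>n. apply_bcontfun (f n) \<omega>) \<longlonglongrightarrow> apply_bcontfun l \<omega>"
      using tendsto_bcontfun_uniform_limit[OF lim] by (rule tendsto_uniform_limitI) simp
    moreover have "\<And>n. apply_bcontfun (f n) \<omega> \<in> P"
      using seq by simp
    ultimately show "apply_bcontfun l \<omega> \<in> P"
      by (rule closed_sequentially[OF assms, rotated])
  qed
  moreover have "pos_part Z P = Z \<inter> {f. \<forall>\<omega>. apply_bcontfun f \<omega> \<in> P}"
    by (auto simp: pos_part_def)
  ultimately show ?thesis
    by (simp add: closedin_closed_Int)
qed

end

theory Submission
  imports Defs
begin

text \<open>
  Everything rests on one continuous map. If \<open>X\<close> is approximately \<open>\<alpha>\<close>-conormal and
  \<open>\<epsilon> > 0\<close>, there is a continuous \<open>\<phi> : X \<rightarrow> P\<close> with \<open>\<phi> x - x \<in> P\<close> and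
  \<open>norm (\<phi> x) \<le> (\<alpha> + \<epsilon>) * norm x\<close> for all \<open>x\<close>. Given a function \<open>f\<close>, the composite
  \<open>\<phi> \<circ> f\<close> is continuous and its norm is pointwise at most \<open>(\<alpha> + \<epsilon>)\<close> times that of \<open>f\<close>,
  so it is again bounded, vanishing at infinity or compactly supported whenever \<open>f\<close> is, and
  \<open>f = \<phi> \<circ> f - (\<phi> \<circ> f - f)\<close> is the required decomposition. The only property of the three
  function spaces that enters is that they are solid: they contain every continuous function whose
  norm is dominated by a multiple of that of a member.
  
  The map \<open>\<phi>\<close> is a continuous selection of the kind that Michael's theorem provides, and is
  constructed here by hand (lemma \<open>exact_continuous_decomposition\<close>) in two steps.
  
  A first approximation averages arbitrary decompositions. Every unit vector \<open>u\<close> has a decomposition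
  \<open>u = s - t\<close> with \<open>s, t \<in> P\<close>; write \<open>x\<close> approximately as a combination of unit vectors near the
  direction of \<open>x\<close>, with non-negative coefficients of total \<open>norm x\<close> that depend continuously on
  \<open>x\<close>, and combine the chosen \<open>s\<close> and \<open>t\<close> with the same coefficients. The coefficients form a
  partition of the function \<open>norm\<close> (lemma \<open>conical_partition\<close>). It need not be locally finite, so
  paracompactness of metric spaces can be bypassed: well-order the centres \<open>y\<close>, give each one a bump
  function \<open>g y\<close>, and take as coefficient at \<open>y\<close> the amount by which \<open>g y\<close> raises the supremum of
  the bump functions at earlier centres. These increments telescope along the well-order, and they
  are continuous because the bump functions have a common Lipschitz constant.
  
  The approximation leaves a remainder \<open>r x\<close> of norm at most \<open>\<eta> * norm x\<close> with \<open>\<eta> < 1\<close>. As in the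
  proof of the open mapping theorem, decomposing the remainders \<open>x, r x, r (r x), \<dots>\<close> and adding
  up gives an exact decomposition; the series converges uniformly on bounded sets, so continuity is
  preserved, at the price of a factor \<open>1 / (1 - \<eta>)\<close> that is arbitrarily close to \<open>1\<close>.
  
  Conversely, a non-zero solid space contains, for a suitable point \<open>\<omega>\<close> and every \<open>x\<close>, a function
  of norm at most \<open>norm x\<close> with value \<open>x\<close> at \<open>\<omega>\<close> (lemma \<open>solid_subspace_attains\<close>); evaluating
  a decomposition of that function at \<open>\<omega>\<close> decomposes \<open>x\<close>.
\<close>

section \<open>Increments of a family of reals along a well-order\<close>

text \<open>
  The added value \<open>0\<close> keeps the supremum defined at the first index and makes it non-negative.
\<close>
definition sup_below :: "('i \<Rightarrow> 'i \<Rightarrow> bool) \<Rightarrow> ('i \<Rightarrow> real) \<Rightarrow> 'i \<Rightarrow> real" where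
  "sup_below lt g i = Sup (insert 0 (g ` {j. lt j i}))"

definition increment :: "('i \<Rightarrow> 'i \<Rightarrow> bool) \<Rightarrow> ('i \<Rightarrow> real) \<Rightarrow> 'i \<Rightarrow> real" where
  "increment lt g i = max 0 (g i - sup_below lt g i)"

lemma increment_nonneg: "0 \<le> increment lt g i"
  by (simp add: increment_def)

lemma bdd_above_below:
  assumes "\<And>j. g j \<le> (M::real)"
  shows "bdd_above (insert 0 (g ` {j. lt j i}))"
  using assms by (auto intro!: bdd_aboveI[of _ "max 0 M"] simp: le_max_iff_disj)

lemma sup_below_upper:
  assumes "\<And>j. g j \<le> M" "lt j i"
  shows "g j \<le> sup_below lt g i"
  unfolding sup_below_def using assms by (intro cSup_upper bdd_above_below) auto

lemma sup_below_nonneg: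
  assumes "\<And>j. g j \<le> M"
  shows "0 \<le> sup_below lt g i"
  unfolding sup_below_def using assms by (intro cSup_upper bdd_above_below) auto

lemma sup_below_least:
  assumes "0 \<le> c" "\<And>j. lt j i \<Longrightarrow> g j \<le> c"
  shows "sup_below lt g i \<le> c"
  unfolding sup_below_def using assms by (intro cSup_least) auto

lemma increment_le:
  assumes "\<And>j. 0 \<le> g j" "\<And>j. g j \<le> M"
  shows "increment lt g i \<le> g i"
  using sup_below_nonneg[of g M lt i] assms by (auto simp: increment_def)

text \<open>
  Remove the last index \<open>m\<close> of \<open>F\<close>. The remaining increments add up to at most the supremum below
  \<open>m\<close>, and the increment at \<open>m\<close> lifts this to at most the maximum with \<open>g m\<close>. The bound \<open>c\<close> must
  dominate \<open>g\<close> at all indices below \<open>F\<close>, not only on \<open>F\<close>, for the induction to go through.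
\<close>
lemma sum_increment_le:
  assumes asym: "asymp lt" and tr: "transp lt" and tot: "totalp lt"
    and bdd: "\<And>j. g j \<le> M"
    and "finite F" "0 \<le> c" "\<And>j. j \<in> F \<Longrightarrow> g j \<le> c" "\<And>j z. j \<in> F \<Longrightarrow> lt z j \<Longrightarrow> g z \<le> c"
  shows "sum (increment lt g) F \<le> c"
  using assms(5-)
proof (induction "card F" arbitrary: F c)
  case 0
  then show ?case by simp
next
  case (Suc n)
  then have "F \<noteq> {}" by auto
  have "\<exists>m\<in>F. \<forall>x\<in>F. x \<noteq> m \<longrightarrow> \<not> lt m x"
    using Finite_Set.bex_max_element[of F lt] Suc.prems(1) \<open>F \<noteq> {}\<close>
      asymp_on_subset[OF asym] transp_on_subset[OF tr] by blast
  then obtain m where m: "m \<in> F" "\<And>x. x \<in> F \<Longrightarrow> x \<noteq> m \<Longrightarrow> lt x m"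
    using tot by (metis UNIV_I totalp_onD)
  have "sum (increment lt g) (F - {m}) \<le> sup_below lt g m"
  proof (rule Suc.hyps(1))
    show "n = card (F - {m})" using Suc m by simp
    show "g j \<le> sup_below lt g m" if "j \<in> F - {m}" for j
      using that m sup_below_upper[of g M, OF bdd] by auto
    show "g z \<le> sup_below lt g m" if "j \<in> F - {m}" "lt z j" for j z
      using that m sup_below_upper[of g M, OF bdd] transpD[OF tr] by (metis DiffD1 DiffD2 singletonI)
  qed (use Suc.prems sup_below_nonneg[of g M, OF bdd] in auto)
  moreover have "sup_below lt g m + increment lt g m = max (sup_below lt g m) (g m)"
    by (simp add: increment_def)
  moreover have "max (sup_below lt g m) (g m) \<le> c"
    using Suc.prems m by (auto intro: sup_below_least)
  moreover have "sum (increment lt g) F = increment lt g m + sum (increment lt g) (F - {m})"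
    using Suc.prems m by (simp add: sum.remove)
  ultimately show ?case by linarith
qed

text \<open>
  The increments telescope to the supremum of \<open>g\<close>, here assumed to be attained at \<open>k\<close>. Finite sums
  stay below it by the previous lemma; conversely, transfinite induction shows that the increments
  up to \<open>i\<close> already add up to at least \<open>g i\<close>. No limit stages need separate treatment because
  \<open>sup_below\<close> is continuous from below.
\<close>
lemma increment_has_sum:
  assumes wf: "wfp lt" and tr: "transp lt" and tot: "totalp lt"
    and nn: "\<And>j. 0 \<le> g j" and bdd: "\<And>j. g j \<le> g k"
  shows "(increment lt g has_sum g k) UNIV"
proof -
  note asym = wfp_imp_asymp[OF wf]
  have fin: "sum (increment lt g) F \<le> g k" if "finite F" for F
    by (rule sum_increment_le[OF asym tr tot]) (use that nn bdd in auto)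
  have summ: "increment lt g summable_on A" for A
    by (rule nonneg_bdd_above_summable_on) (use fin increment_nonneg in \<open>auto intro!: bdd_aboveI\<close>)
  let ?T = "\<lambda>A. infsum (increment lt g) A"
  have mono: "?T A \<le> ?T B" if "A \<subseteq> B" for A B
    by (rule infsum_mono_neutral) (use that summ increment_nonneg in auto)
  have "g i \<le> ?T (insert i {j. lt j i})" for i
    using wf
  proof (induction i rule: wfp_induct_rule)
    case (less i)
    have "sup_below lt g i \<le> ?T {j. lt j i}"
    proof (rule sup_below_least)
      show "0 \<le> ?T {j. lt j i}" by (rule infsum_nonneg) (rule increment_nonneg)
      fix z assume z: "lt z i"
      then have "insert z {j. lt j z} \<subseteq> {j. lt j i}"
        using transpD[OF tr] by auto
      from less[OF z] mono[OF this] show "g z \<le> ?T {j. lt j i}" by linarith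
    qed
    moreover have "?T (insert i {j. lt j i}) = increment lt g i + ?T {j. lt j i}"
      using asympD[OF asym] by (subst infsum_insert) (auto intro: summ)
    moreover have "g i \<le> sup_below lt g i + increment lt g i"
      by (simp add: increment_def)
    ultimately show ?case by linarith
  qed
  from this[of k] have "g k \<le> ?T UNIV"
    using mono[of "insert k {j. lt j k}" UNIV] by simp
  moreover have "?T UNIV \<le> g k"
    by (rule infsum_le_finite_sums[OF summ]) (use fin in auto)
  ultimately show ?thesis
    using has_sum_infsum[OF summ, of UNIV] by (metis order_antisym)
qed

section \<open>A continuous partition of the norm\<close>

lemma ex_wellorder_predicate: "\<exists>lt :: 'i \<Rightarrow> 'i \<Rightarrow> bool. wfp lt \<and> transp lt \<and> totalp lt"
proof -
  obtain r :: "'i rel" where r: "Well_order r" "Field r = UNIV"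
    using well_ordering[where 'a = 'i] by auto
  then have "wf (r - Id)" "trans (r - Id)" "total (r - Id)"
    by (auto simp: order_on_defs intro: trans_diff_Id)
  then have "wfp (\<lambda>x y. (x, y) \<in> r - Id)" "transp (\<lambda>x y. (x, y) \<in> r - Id)"
    "totalp (\<lambda>x y. (x, y) \<in> r - Id)"
    by (simp_all only: wfp_def transp_trans_eq totalp_on_total_on_eq case_prod_conv split_def prod.collapse Collect_mem_eq)
  then show ?thesis by blast
qed

lemma continuous_on_sup_below:
  fixes g :: "'i \<Rightarrow> 'a::metric_space \<Rightarrow> real"
  assumes lip: "\<And>j. L-lipschitz_on UNIV (g j)" and bdd: "\<And>j x. g j x \<le> M x"
  shows "continuous_on UNIV (\<lambda>x. sup_below lt (\<lambda>j. g j x) i)"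
proof -
  have L: "0 \<le> L" using lipschitz_on_nonneg[OF lip] .
  have le: "sup_below lt (\<lambda>j. g j x) i \<le> sup_below lt (\<lambda>j. g j y) i + L * dist x y" for x y
  proof (rule sup_below_least)
    show "0 \<le> sup_below lt (\<lambda>j. g j y) i + L * dist x y"
      using sup_below_nonneg[of "\<lambda>j. g j y" "M y" lt i] bdd L by simp
    fix j assume "lt j i"
    then have "g j y \<le> sup_below lt (\<lambda>j. g j y) i"
      by (rule sup_below_upper[where g = "\<lambda>j. g j y", OF bdd])
    moreover have "\<bar>g j x - g j y\<bar> \<le> L * dist x y"
      using lipschitz_onD[OF lip, of x y j] by (simp add: dist_real_def)
    ultimately show "g j x \<le> sup_below lt (\<lambda>j. g j y) i + L * dist x y" by linarith
  qed
  have "L-lipschitz_on UNIV (\<lambda>x. sup_below lt (\<lambda>j. g j x) i)"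
  proof (rule lipschitz_onI[OF _ L])
    fix x y
    show "dist (sup_below lt (\<lambda>j. g j x) i) (sup_below lt (\<lambda>j. g j y) i) \<le> L * dist x y"
      using le[of x y] le[of y x] by (simp add: dist_real_def dist_commute abs_le_iff)
  qed
  then show ?thesis by (rule lipschitz_on_continuous_on)
qed

text \<open>
  The weight \<open>w y x\<close> is the increment at \<open>y\<close> of the bump functions
  \<open>g y x = max 0 (norm x - norm (x - norm x *\<^sub>R sgn y) / \<eta>)\<close>, each of which is positive only where
  \<open>sgn x\<close> is within \<open>\<eta>\<close> of \<open>sgn y\<close>. Multiplying \<open>sgn y\<close> by \<open>norm x\<close>
  instead of dividing \<open>x\<close> by it makes the bump functions Lipschitz up to and including the origin.
  All of them are at most \<open>norm x\<close>, with equality for \<open>y = x\<close>, so the increments add up to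
  \<open>norm x\<close>.
\<close>
lemma conical_partition:
  fixes \<eta> :: real
  assumes "\<eta> > 0"
  obtains w :: "'a::real_normed_vector \<Rightarrow> 'a \<Rightarrow> real" where
    "\<And>y. continuous_on UNIV (w y)" "\<And>y x. 0 \<le> w y x"
    "\<And>x. ((\<lambda>y. w y x) has_sum norm x) UNIV"
    "\<And>y x. w y x \<noteq> 0 \<Longrightarrow> norm (x - norm x *\<^sub>R sgn y) \<le> \<eta> * norm x"
proof -
  obtain lt :: "'a \<Rightarrow> 'a \<Rightarrow> bool" where lt: "wfp lt" "transp lt" "totalp lt"
    using ex_wellorder_predicate by blast
  define g where "g y x = max 0 (norm x - norm (x - norm x *\<^sub>R sgn y) / \<eta>)" for y x :: 'a
  define w where "w y x = increment lt (\<lambda>y. g y x) y" for y x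
  have g0: "0 \<le> g y x" and g1: "g y x \<le> norm x" for x y
    using assms by (auto simp: g_def)
  have self: "g x x = norm x" for x
    by (cases "x = 0") (auto simp: g_def sgn_div_norm)
  have g2: "(1 + 2/\<eta>)-lipschitz_on UNIV (g y)" for y
  proof (rule lipschitz_onI)
    fix x x'
    have "norm (x - norm x *\<^sub>R sgn y) - norm (x' - norm x' *\<^sub>R sgn y)
        \<le> norm ((x - x') - (norm x - norm x') *\<^sub>R sgn y)" for x x'
      using norm_triangle_ineq2[of "x - norm x *\<^sub>R sgn y" "x' - norm x' *\<^sub>R sgn y"]
      by (simp add: algebra_simps)
    moreover have "norm ((x - x') - (norm x - norm x') *\<^sub>R sgn y) \<le> 2 * norm (x - x')" for x x'
    proof -
      have "norm ((norm x - norm x') *\<^sub>R sgn y) \<le> norm (x - x') * 1"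
        unfolding norm_scaleR by (intro mult_mono) (auto simp: norm_sgn norm_triangle_ineq3)
      then show ?thesis
        using norm_triangle_ineq4[of "x - x'" "(norm x - norm x') *\<^sub>R sgn y"] by simp
    qed
    ultimately have le: "norm (x - norm x *\<^sub>R sgn y) - norm (x' - norm x' *\<^sub>R sgn y)
        \<le> 2 * norm (x - x')" for x x'
      by (rule order_trans)
    have "\<bar>norm (x - norm x *\<^sub>R sgn y) - norm (x' - norm x' *\<^sub>R sgn y)\<bar> \<le> 2 * norm (x - x')"
      using le[of x x'] le[of x' x] by (simp add: abs_le_iff norm_minus_commute)
    then have "\<bar>norm (x - norm x *\<^sub>R sgn y) / \<eta> - norm (x' - norm x' *\<^sub>R sgn y) / \<eta>\<bar>
        \<le> 2 / \<eta> * norm (x - x')"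
      using assms by (simp add: diff_divide_distrib[symmetric] abs_divide divide_right_mono)
    moreover have "\<bar>norm x - norm x'\<bar> \<le> norm (x - x')"
      by (rule norm_triangle_ineq3)
    ultimately show "dist (g y x) (g y x') \<le> (1 + 2/\<eta>) * dist x x'"
      unfolding g_def dist_norm real_norm_def distrib_right by linarith
  qed (use assms in simp)
  show thesis
  proof
    show "continuous_on UNIV (w y)" for y
      unfolding w_def increment_def
      by (intro continuous_intros continuous_on_sup_below[OF g2 g1]
          lipschitz_on_continuous_on[OF g2])
    show "0 \<le> w y x" for y x
      by (simp add: w_def increment_nonneg)
    show "((\<lambda>y. w y x) has_sum norm x) UNIV" for x
      using increment_has_sum[OF lt, of "\<lambda>y. g y x" x] g0 g1 self by (simp add: w_def)
    show "norm (x - norm x *\<^sub>R sgn y) \<le> \<eta> * norm x" if "w y x \<noteq> 0" for y x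
    proof -
      have "w y x \<le> g y x"
        unfolding w_def by (rule increment_le[OF g0 g1])
      then have "0 < g y x"
        using that increment_nonneg[of lt "\<lambda>y. g y x" y] by (simp add: w_def)
      then have "norm (x - norm x *\<^sub>R sgn y) / \<eta> < norm x"
        by (auto simp: g_def split: if_splits simp: max_def)
      then show ?thesis
        using assms by (simp add: field_simps)
    qed
  qed
qed

section \<open>Weighted sums of bounded families\<close>

lemma weighted_has_sum:
  fixes s :: "'i \<Rightarrow> 'b::banach"
  assumes "\<And>y. 0 \<le> w y" "(w has_sum W) A" "\<And>y. y \<in> A \<Longrightarrow> w y \<noteq> 0 \<Longrightarrow> norm (s y) \<le> B"
  shows "((\<lambda>y. w y *\<^sub>R s y) has_sum (\<Sum>\<^sub>\<infinity>y\<in>A. w y *\<^sub>R s y)) A"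
    and "norm (\<Sum>\<^sub>\<infinity>y\<in>A. w y *\<^sub>R s y) \<le> B * W"
proof -
  have le: "norm (w y *\<^sub>R s y) \<le> B * w y" if "y \<in> A" for y
    using assms(1)[of y] assms(3)[OF that] by (cases "w y = 0") (auto simp: mult.commute mult_right_mono)
  have BW: "((\<lambda>y. B * w y) has_sum B * W) A"
    by (rule has_sum_cmult_right[OF assms(2)])
  have abs: "(\<lambda>y. w y *\<^sub>R s y) abs_summable_on A"
    by (rule summable_on_comparison_test[of "\<lambda>y. B * w y"]) (use le BW in \<open>auto simp: summable_on_def\<close>)
  show sum: "((\<lambda>y. w y *\<^sub>R s y) has_sum (\<Sum>\<^sub>\<infinity>y\<in>A. w y *\<^sub>R s y)) A"
    by (rule has_sum_infsum[OF abs_summable_summable[OF abs]])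
  have "norm (\<Sum>\<^sub>\<infinity>y\<in>A. w y *\<^sub>R s y) \<le> (\<Sum>\<^sub>\<infinity>y\<in>A. norm (w y *\<^sub>R s y))"
    by (rule norm_infsum_bound[OF abs])
  also have "\<dots> \<le> B * W"
    by (rule has_sum_mono[OF has_sum_infsum[OF abs] BW le])
  finally show "norm (\<Sum>\<^sub>\<infinity>y\<in>A. w y *\<^sub>R s y) \<le> B * W" .
qed

text \<open>
  At \<open>x0\<close>, finitely many indices \<open>F\<close> carry nearly all of the weight \<open>W x0\<close>. The weight \<open>R x\<close> that
  is left over equals \<open>W x\<close> minus a finite sum of continuous functions, hence stays small near \<open>x0\<close>
  and bounds the tails of the sum uniformly. Continuity of the total weight thus replaces local
  finiteness.
\<close>
lemma continuous_on_weighted_sum: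
  fixes w :: "'i \<Rightarrow> 'a::topological_space \<Rightarrow> real" and s :: "'i \<Rightarrow> 'b::banach"
  assumes cont: "\<And>y. continuous_on UNIV (w y)" and nn: "\<And>y x. 0 \<le> w y x"
    and sum: "\<And>x. ((\<lambda>y. w y x) has_sum W x) UNIV" and W: "continuous_on UNIV W"
    and B: "\<And>y. norm (s y) \<le> B"
  shows "continuous_on UNIV (\<lambda>x. \<Sum>\<^sub>\<infinity>y. w y x *\<^sub>R s y)"
  unfolding continuous_on_def
proof (rule ballI, unfold tendsto_iff, intro allI impI)
  fix x0 and e :: real
  assume e: "e > 0"
  let ?f = "\<lambda>x. \<Sum>\<^sub>\<infinity>y. w y x *\<^sub>R s y"
  have B0: "0 \<le> B" using B norm_ge_zero order_trans by blast
  \<comment> \<open>\<open>B + 1\<close> rather than \<open>B\<close>, since \<open>B\<close> may vanish.\<close>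
  define d where "d = e / (3 * (B + 1))"
  have d: "d > 0" "B * d < e / 3" using e B0 by (auto simp: d_def field_simps)
  have "\<forall>\<^sub>F F in finite_subsets_at_top UNIV. dist (\<Sum>y\<in>F. w y x0) (W x0) < d"
    using sum[of x0] d(1) by (simp add: has_sum_def tendsto_iff)
  then obtain F where F: "finite F" "dist (\<Sum>y\<in>F. w y x0) (W x0) < d"
    unfolding eventually_finite_subsets_at_top by (meson subset_UNIV subset_refl)
  define R where "R x = W x - (\<Sum>y\<in>F. w y x)" for x
  have R: "((\<lambda>y. w y x) has_sum R x) (- F)" for x
    using has_sum_Diff[OF sum[of x] has_sum_finite[OF F(1)]] by (simp add: R_def Compl_eq_Diff_UNIV)
  have approx: "norm (?f x - (\<Sum>y\<in>F. w y x *\<^sub>R s y)) \<le> B * R x" for x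
  proof -
    have "((\<lambda>y. w y x *\<^sub>R s y) has_sum ?f x - (\<Sum>y\<in>F. w y x *\<^sub>R s y)) (- F)"
      using has_sum_Diff[OF weighted_has_sum(1)[OF nn sum[of x] B] has_sum_finite[OF F(1)]]
      by (simp add: Compl_eq_Diff_UNIV)
    from infsumI[OF this] show ?thesis
      using weighted_has_sum(2)[where s = s, OF nn R[of x] B] by simp
  qed
  have "R x0 < d" using F(2) by (simp add: R_def dist_real_def)
  moreover have "continuous_on UNIV R"
    unfolding R_def by (intro continuous_intros W cont)
  ultimately have ev1: "\<forall>\<^sub>F x in at x0. R x < d"
    by (auto simp: continuous_on_def intro: order_tendstoD)
  have "continuous_on UNIV (\<lambda>x. \<Sum>y\<in>F. w y x *\<^sub>R s y)"
    by (intro continuous_intros cont)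
  then have "((\<lambda>x. \<Sum>y\<in>F. w y x *\<^sub>R s y) \<longlongrightarrow> (\<Sum>y\<in>F. w y x0 *\<^sub>R s y)) (at x0)"
    by (auto simp: continuous_on_def)
  then have ev2: "\<forall>\<^sub>F x in at x0. dist (\<Sum>y\<in>F. w y x *\<^sub>R s y) (\<Sum>y\<in>F. w y x0 *\<^sub>R s y) < e / 3"
    by (rule tendstoD) (use e in simp)
  have "\<forall>\<^sub>F x in at x0. dist (?f x) (?f x0) < e"
    using ev1 ev2
  proof eventually_elim
    case (elim x)
    have "B * R x \<le> B * d" "B * R x0 \<le> B * d"
      using elim(1) \<open>R x0 < d\<close> B0 by (auto intro!: mult_left_mono)
    then have fx: "dist (?f x) (\<Sum>y\<in>F. w y x *\<^sub>R s y) < e/3"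
      and fx0: "dist (\<Sum>y\<in>F. w y x0 *\<^sub>R s y) (?f x0) < e/3"
      using approx[of x] approx[of x0] d(2) by (simp_all add: dist_norm norm_minus_commute)
    show ?case
      by (rule dist_triangle_third[OF fx elim(2) fx0])
  qed
  then show "\<forall>\<^sub>F x in at x0 within UNIV. dist (?f x) (?f x0) < e" by simp
qed

section \<open>Continuous decomposition in a conormal space\<close>

lemma has_sum_in_closed_cone:
  fixes P :: "'a::real_normed_vector set"
  assumes "convex_cone P" "closed P" "(f has_sum s) A" "\<And>y. y \<in> A \<Longrightarrow> f y \<in> P"
  shows "s \<in> P"
proof (rule Lim_in_closed_set[OF assms(2)])
  have "sum f F \<in> P" if "finite F" "F \<subseteq> A" for F
    using that assms(1,4) by (induction rule: finite_induct) (auto simp: convex_cone_iff)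
  then show "\<forall>\<^sub>F F in finite_subsets_at_top A. sum f F \<in> P"
    by (rule eventually_finite_subsets_at_top_weakI)
  show "(sum f \<longlongrightarrow> s) (finite_subsets_at_top A)"
    using assms(3) by (simp add: has_sum_def)
qed simp

text \<open>
  The decompositions \<open>sgn y = s y - t y\<close> are chosen without any regularity in \<open>y\<close>; continuity comes
  from the weights alone. The error is a weighted sum of the deviations \<open>sgn x - sgn y\<close>, which have
  norm at most \<open>\<eta>\<close> wherever the weight is non-zero.
\<close>
lemma approximate_continuous_decomposition:
  fixes P :: "'a::banach set"
  assumes P: "convex_cone P" "closed P" and con: "conormal a UNIV P" and a: "0 \<le> a" and "\<eta> > 0"
  obtains p q :: "'a \<Rightarrow> 'a" where
    "continuous_on UNIV p" "continuous_on UNIV q" "\<And>x. p x \<in> P" "\<And>x. q x \<in> P"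
    "\<And>x. norm (p x) \<le> a * norm x" "\<And>x. norm (x - (p x - q x)) \<le> \<eta> * norm x"
proof -
  obtain w :: "'a \<Rightarrow> 'a \<Rightarrow> real" where w: "\<And>y. continuous_on UNIV (w y)" "\<And>y x. 0 \<le> w y x"
    "\<And>x. ((\<lambda>y. w y x) has_sum norm x) UNIV"
    "\<And>y x. w y x \<noteq> 0 \<Longrightarrow> norm (x - norm x *\<^sub>R sgn y) \<le> \<eta> * norm x"
    using conical_partition[OF \<open>\<eta> > 0\<close>] by metis
  have "\<forall>y. \<exists>s t. s \<in> P \<and> t \<in> P \<and> sgn y = s - t \<and> norm s \<le> a * norm (sgn y)"
    using con by (simp add: conormal_def) blast
  then obtain s t where st: "\<And>y. s y \<in> P" "\<And>y. t y \<in> P" "\<And>y. sgn y = s y - t y"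
    "\<And>y. norm (s y) \<le> a * norm (sgn y)"
    by metis
  have bs: "norm (s y) \<le> a" for y
    using st(4)[of y] a by (auto simp: norm_sgn split: if_splits)
  have bt: "norm (t y) \<le> a + 1" for y
  proof -
    have "t y = s y - sgn y" using st(3)[of y] by simp
    then have "norm (t y) \<le> norm (s y) + norm (sgn y)" by (simp add: norm_triangle_ineq4)
    also have "\<dots> \<le> a + 1" using bs[of y] by (auto simp: norm_sgn)
    finally show ?thesis .
  qed
  define p where "p x = (\<Sum>\<^sub>\<infinity>y. w y x *\<^sub>R s y)" for x
  define q where "q x = (\<Sum>\<^sub>\<infinity>y. w y x *\<^sub>R t y)" for x
  have hp: "((\<lambda>y. w y x *\<^sub>R s y) has_sum p x) UNIV" for x
    unfolding p_def by (rule weighted_has_sum(1)[OF w(2,3) bs])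
  have hq: "((\<lambda>y. w y x *\<^sub>R t y) has_sum q x) UNIV" for x
    unfolding q_def by (rule weighted_has_sum(1)[OF w(2,3) bt])
  show thesis
  proof
    show "continuous_on UNIV p" "continuous_on UNIV q"
      unfolding p_def q_def
      by (rule continuous_on_weighted_sum[OF w(1-3) continuous_on_norm_id bs]
          continuous_on_weighted_sum[OF w(1-3) continuous_on_norm_id bt])+
    show "p x \<in> P" "q x \<in> P" for x
      using has_sum_in_closed_cone[OF P hp[of x]] has_sum_in_closed_cone[OF P hq[of x]] st(1,2) w(2) P(1)
      by (auto simp: convex_cone_iff)
    show "norm (p x) \<le> a * norm x" for x
      unfolding p_def by (rule weighted_has_sum(2)[OF w(2,3) bs])
    show "norm (x - (p x - q x)) \<le> \<eta> * norm x" for x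
    proof (cases "x = 0")
      case True
      then have "w y x = 0" for y
        using nonneg_has_sum_le_0D[OF w(3)[of x]] w(2) by simp
      then show ?thesis using True by (simp add: p_def q_def)
    next
      case False
      define e where "e y = sgn x - sgn y" for y
      have scale: "x - norm x *\<^sub>R sgn y = norm x *\<^sub>R e y" for y
        using False by (simp add: e_def sgn_div_norm scaleR_diff_right)
      have be: "norm (e y) \<le> \<eta>" if "w y x \<noteq> 0" for y
        using w(4)[OF that] False unfolding scale by (simp add: mult.commute)
      have "((\<lambda>y. w y x *\<^sub>R sgn x) has_sum norm x *\<^sub>R sgn x) UNIV"
        using has_sum_bounded_linear[OF bounded_linear_scaleR_left w(3)] .
      moreover have "((\<lambda>y. - (w y x *\<^sub>R s y)) has_sum - p x) UNIV"
        using hp by (simp add: has_sum_uminus)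
      ultimately have "((\<lambda>y. w y x *\<^sub>R sgn x + - (w y x *\<^sub>R s y) + w y x *\<^sub>R t y)
          has_sum norm x *\<^sub>R sgn x + - p x + q x) UNIV"
        by (intro has_sum_add hq)
      moreover have "w y x *\<^sub>R sgn x + - (w y x *\<^sub>R s y) + w y x *\<^sub>R t y = w y x *\<^sub>R e y" for y
        by (simp add: e_def st(3) scaleR_diff_right)
      ultimately have "((\<lambda>y. w y x *\<^sub>R e y) has_sum x - (p x - q x)) UNIV"
        using False by (simp add: sgn_div_norm algebra_simps)
      from infsumI[OF this] show ?thesis
        using weighted_has_sum(2)[where s = e, OF w(2) w(3)[of x] be] by simp
    qed
  qed
qed

text \<open>
  Iterate the approximate decomposition \<open>p - q\<close> on its remainder \<open>r x = x - (p x - q x)\<close> and put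
  \<open>\<phi> x = (\<Sum>n. p ((r ^^ n) x))\<close>. Since the remainders \<open>(r ^^ n) x\<close> tend to \<open>0\<close> geometrically, the
  sum of \<open>(p - q) ((r ^^ n) x)\<close> telescopes to \<open>x\<close>, so \<open>\<phi> x - x\<close> is the corresponding sum of \<open>q\<close>.
\<close>
lemma exact_continuous_decomposition:
  fixes P :: "'a::banach set"
  assumes P: "convex_cone P" "closed P" and con: "conormal a UNIV P" and a: "0 \<le> a"
    and \<eta>: "0 < \<eta>" "\<eta> < 1"
  obtains \<phi> :: "'a \<Rightarrow> 'a" where
    "continuous_on UNIV \<phi>" "\<And>x. \<phi> x \<in> P" "\<And>x. \<phi> x - x \<in> P"
    "\<And>x. norm (\<phi> x) \<le> a / (1 - \<eta>) * norm x"
proof -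
  obtain p q :: "'a \<Rightarrow> 'a" where
    cont: "continuous_on UNIV p" "continuous_on UNIV q" and pos: "\<And>x. p x \<in> P" "\<And>x. q x \<in> P"
    and pb: "\<And>x. norm (p x) \<le> a * norm x" and rb: "\<And>x. norm (x - (p x - q x)) \<le> \<eta> * norm x"
    using approximate_continuous_decomposition[OF P con a \<eta>(1)] by metis
  define r where "r x = x - (p x - q x)" for x
  have rn: "norm ((r ^^ n) x) \<le> \<eta> ^ n * norm x" for n x
  proof (induction n)
    case (Suc n)
    have "norm ((r ^^ Suc n) x) \<le> \<eta> * norm ((r ^^ n) x)"
      using rb by (simp add: r_def)
    also have "\<dots> \<le> \<eta> * (\<eta> ^ n * norm x)" using Suc \<eta> by (intro mult_left_mono) auto
    finally show ?case by (simp add: mult.assoc)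
  qed simp
  have contrn: "continuous_on UNIV (r ^^ n)" for n
  proof (induction n)
    case (Suc n)
    have "continuous_on UNIV r" unfolding r_def by (intro continuous_intros cont)
    then show ?case
      using continuous_on_compose[OF Suc continuous_on_subset[of UNIV r]] by simp
  qed (simp add: id_def)
  have term_le: "norm (p ((r ^^ n) x)) \<le> a * (\<eta> ^ n * norm x)" for n x
    using pb[of "(r ^^ n) x"] mult_left_mono[OF rn[of n x] a] by linarith
  have geo: "(\<lambda>n. a * (\<eta> ^ n * R)) sums (a / (1 - \<eta>) * R)" for R
    using sums_mult[OF sums_mult2[OF geometric_sums[of \<eta>]], of a R] \<eta> by simp
  define \<phi> where "\<phi> x = (\<Sum>n. p ((r ^^ n) x))" for x
  have summ: "summable (\<lambda>n. p ((r ^^ n) x))" for x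
    by (rule summable_comparison_test[OF _ sums_summable[OF geo]]) (use term_le in blast)
  have closed_sums: "z \<in> P" if "f sums z" "\<And>n. f n \<in> P" for f :: "nat \<Rightarrow> 'a" and z
  proof (rule closed_sequentially[OF P(2)])
    show "(\<Sum>i<n. f i) \<in> P" for n
      using that(2) P(1) by (induction n) (auto simp: convex_cone_iff)
  qed (use that(1) in \<open>simp add: sums_def\<close>)
  show thesis
  proof
    show "continuous_on UNIV \<phi>"
    proof -
      have "continuous_on (ball 0 R) \<phi>" for R
      proof (rule uniform_limit_theorem)
        show "uniform_limit (ball 0 R) (\<lambda>n x. \<Sum>i<n. p ((r ^^ i) x)) \<phi> sequentially"
          unfolding \<phi>_def
        proof (rule Weierstrass_m_test[OF _ sums_summable[OF geo[of R]]])
          fix n and x :: 'a assume "x \<in> ball 0 R"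
          then have "a * (\<eta> ^ n * norm x) \<le> a * (\<eta> ^ n * R)"
            using a \<eta> by (intro mult_left_mono) auto
          then show "norm (p ((r ^^ n) x)) \<le> a * (\<eta> ^ n * R)"
            using term_le[of n x] by linarith
        qed
        show "\<forall>\<^sub>F n in sequentially. continuous_on (ball 0 R) (\<lambda>x. \<Sum>i<n. p ((r ^^ i) x))"
          by (intro always_eventually allI continuous_intros)
            (auto intro!: continuous_on_compose2[OF cont(1) continuous_on_subset[OF contrn]])
      qed simp
      then have "isCont \<phi> x" for x
        using continuous_on_interior[of "ball 0 (norm x + 1)" \<phi> x] by simp
      then show ?thesis by (simp add: continuous_at_imp_continuous_on)
    qed
    show "\<phi> x \<in> P" for x
      using closed_sums[OF summable_sums[OF summ]] pos unfolding \<phi>_def by blast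
    show "\<phi> x - x \<in> P" for x
    proof -
      have "(\<lambda>n. \<eta> ^ n * norm x) \<longlonglongrightarrow> 0"
        using \<eta> by (intro tendsto_mult_left_zero LIMSEQ_power_zero) simp
      then have "(\<lambda>n. (r ^^ n) x) \<longlonglongrightarrow> 0"
        by (rule Lim_null_comparison[rotated]) (simp add: rn always_eventually)
      from telescope_sums[OF this] have "(\<lambda>n. (r ^^ Suc n) x - (r ^^ n) x) sums (0 - x)"
        by simp
      from sums_add[OF summable_sums[OF summ[of x]] this]
      have "(\<lambda>n. q ((r ^^ n) x)) sums (\<phi> x - x)"
        by (simp add: \<phi>_def r_def)
      then show ?thesis using closed_sums pos by blast
    qed
    show "norm (\<phi> x) \<le> a / (1 - \<eta>) * norm x" for x
      unfolding \<phi>_def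
      unfolding sums_unique[OF geo]
      by (rule norm_suminf_le[OF term_le sums_summable[OF geo]])
  qed
qed

section \<open>Solid spaces of bounded continuous functions\<close>

definition solid_subspace :: "('b::topological_space \<Rightarrow>\<^sub>C 'a::real_normed_vector) set \<Rightarrow> bool" where
  "solid_subspace Z \<longleftrightarrow> subspace Z \<and>
    (\<forall>f\<in>Z. \<forall>g c. (\<forall>\<omega>. norm (apply_bcontfun g \<omega>) \<le> c * norm (apply_bcontfun f \<omega>)) \<longrightarrow> g \<in> Z)"

lemma solid_subspace_Cb: "solid_subspace Cb"
  by (simp add: solid_subspace_def)

lemma solid_subspace_C0:
  "solid_subspace (C0 :: ('b::topological_space \<Rightarrow>\<^sub>C 'a::real_normed_vector) set)"
  unfolding solid_subspace_def
proof (intro conjI subspace_C0 ballI allI impI)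
  fix f g :: "'b \<Rightarrow>\<^sub>C 'a" and c
  assume f: "f \<in> C0" and le: "\<forall>\<omega>. norm (apply_bcontfun g \<omega>) \<le> c * norm (apply_bcontfun f \<omega>)"
  show "g \<in> C0" unfolding C0_def
  proof safe
    fix e :: real assume e: "e > 0"
    let ?S = "\<lambda>h c. {\<omega>. norm (apply_bcontfun h \<omega>) \<ge> c}"
    \<comment> \<open>The constant \<open>c\<close> may be zero or negative and is enlarged before dividing by it.\<close>
    have c: "0 < \<bar>c\<bar> + 1" by simp
    have "?S g e \<subseteq> ?S f (e / (\<bar>c\<bar> + 1))"
    proof safe
      fix \<omega> assume "e \<le> norm (apply_bcontfun g \<omega>)"
      also have "\<dots> \<le> c * norm (apply_bcontfun f \<omega>)" using le by blast
      also have "\<dots> \<le> (\<bar>c\<bar> + 1) * norm (apply_bcontfun f \<omega>)" by (intro mult_right_mono) auto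
      finally show "e / (\<bar>c\<bar> + 1) \<le> norm (apply_bcontfun f \<omega>)"
        using c by (simp add: pos_divide_le_eq mult.commute)
    qed
    moreover have "compact (?S f (e / (\<bar>c\<bar> + 1)))"
      using f divide_pos_pos[OF e c] unfolding C0_def by blast
    ultimately show "compact (?S g e)"
      by (metis closed_superlevel closed_Int_compact inf.absorb1)
  qed
qed

lemma solid_subspace_Cc:
  "solid_subspace (Cc :: ('b::topological_space \<Rightarrow>\<^sub>C 'a::real_normed_vector) set)"
  unfolding solid_subspace_def
proof (intro conjI subspace_Cc ballI allI impI)
  fix f g :: "'b \<Rightarrow>\<^sub>C 'a" and c
  assume f: "f \<in> Cc" and le: "\<forall>\<omega>. norm (apply_bcontfun g \<omega>) \<le> c * norm (apply_bcontfun f \<omega>)"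
  have "{\<omega>. apply_bcontfun g \<omega> \<noteq> 0} \<subseteq> {\<omega>. apply_bcontfun f \<omega> \<noteq> 0}"
  proof safe
    fix \<omega> assume "apply_bcontfun g \<omega> \<noteq> 0" "apply_bcontfun f \<omega> = 0"
    then show False using le[rule_format, of \<omega>] by simp
  qed
  then show "g \<in> Cc"
    using f unfolding Cc_def mem_Collect_eq
    by (metis closed_Int_compact closed_closure closure_mono inf.absorb1)
qed

text \<open>
  Compose with the continuous decomposition map. Half of \<open>\<epsilon>\<close> is spent on conormality of the value
  space, and \<open>\<eta>\<close> is chosen so that the factor \<open>1 / (1 - \<eta>)\<close> consumes exactly the other half.
\<close>
lemma approx_conormal_solid_subspace:
  fixes P :: "'a::banach set" and Z :: "('b::topological_space \<Rightarrow>\<^sub>C 'a) set"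
  assumes P: "convex_cone P" "closed P" and \<alpha>: "\<alpha> > 0" and Z: "solid_subspace Z"
    and ac: "approx_conormal \<alpha> UNIV P"
  shows "approx_conormal \<alpha> Z (pos_part Z P)"
  unfolding approx_conormal_def conormal_def
proof (intro allI impI ballI)
  fix \<epsilon> :: real and f assume \<epsilon>: "\<epsilon> > 0" and f: "f \<in> Z"
  define a where "a = \<alpha> + \<epsilon> / 2"
  define \<eta> where "\<eta> = (\<epsilon> / 2) / (\<alpha> + \<epsilon>)"
  have \<eta>: "0 < \<eta>" "\<eta> < 1" and a: "0 \<le> a"
    using \<epsilon> \<alpha> by (auto simp: \<eta>_def a_def field_simps)
  have "1 - \<eta> = a / (\<alpha> + \<epsilon>)"
    using \<epsilon> \<alpha> by (simp add: \<eta>_def a_def field_simps)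
  then have quot: "a / (1 - \<eta>) = \<alpha> + \<epsilon>"
    using \<epsilon> \<alpha> by (simp add: a_def)
  have "conormal a UNIV P"
    using ac \<epsilon> half_gt_zero[OF \<epsilon>] unfolding approx_conormal_def a_def by blast
  from exact_continuous_decomposition[OF P this a \<eta>]
  obtain \<phi> where \<phi>: "continuous_on UNIV \<phi>" "\<And>x. \<phi> x \<in> P" "\<And>x. \<phi> x - x \<in> P"
    "\<And>x. norm (\<phi> x) \<le> (\<alpha> + \<epsilon>) * norm x"
    unfolding quot by metis
  let ?h = "\<lambda>\<omega>. \<phi> (apply_bcontfun f \<omega>)"
  have bound: "norm (?h \<omega>) \<le> (\<alpha> + \<epsilon>) * norm f" for \<omega>
    using \<phi>(4)[of "apply_bcontfun f \<omega>"] mult_left_mono[OF norm_bounded[of f \<omega>], of "\<alpha> + \<epsilon>"] \<alpha> \<epsilon>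
    by linarith
  have "?h \<in> bcontfun"
    by (rule bcontfun_normI[OF continuous_on_compose2[OF \<phi>(1)] bound]) (auto intro: continuous_intros)
  then obtain h where h: "\<And>\<omega>. apply_bcontfun h \<omega> = ?h \<omega>"
    by (metis Bcontfun_inverse)
  have hZ: "h \<in> Z"
    using Z f \<phi>(4) h unfolding solid_subspace_def by metis
  have "h - f \<in> Z"
    using Z f hZ subspace_diff unfolding solid_subspace_def by blast
  moreover have "norm h \<le> (\<alpha> + \<epsilon>) * norm f"
    by (rule norm_bound) (use bound h in simp)
  ultimately show "\<exists>zp\<in>pos_part Z P. \<exists>zn\<in>pos_part Z P. f = zp - zn \<and> norm zp \<le> (\<alpha> + \<epsilon>) * norm f"
    using hZ \<phi>(2,3) by (intro bexI[of _ h] bexI[of _ "h - f"]) (auto simp: pos_part_def h)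
qed

text \<open>
  Scale \<open>x\<close> by the cut-off \<open>min 1 (norm (f \<omega>') / norm (f \<omega>))\<close>, where \<open>f\<close> is a member that does
  not vanish at \<open>\<omega>\<close>. It is \<open>1\<close> at \<open>\<omega>\<close>, never exceeds \<open>1\<close>, and is dominated by a multiple of
  the norm of \<open>f\<close>, which puts the product into \<open>Z\<close>.
\<close>
lemma solid_subspace_attains:
  fixes Z :: "('b::topological_space \<Rightarrow>\<^sub>C 'a::real_normed_vector) set"
  assumes Z: "solid_subspace Z" "Z \<noteq> {0}"
  obtains \<omega> where "\<And>x. \<exists>f\<in>Z. apply_bcontfun f \<omega> = x \<and> norm f \<le> norm x"
proof -
  have "0 \<in> Z" using Z(1) by (auto simp: solid_subspace_def subspace_0)
  with Z(2) obtain f where f: "f \<in> Z" "f \<noteq> 0" by blast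
  then obtain \<omega> where \<omega>: "apply_bcontfun f \<omega> \<noteq> 0"
    by (metis bcontfun_eqI zero_bcontfun.rep_eq)
  define k where "k = norm (apply_bcontfun f \<omega>)"
  have k: "k > 0" using \<omega> by (simp add: k_def)
  show thesis
  proof
    fix x :: 'a
    define g where "g \<omega>' = min 1 (norm (apply_bcontfun f \<omega>') / k) *\<^sub>R x" for \<omega>'
    have b: "norm (g \<omega>') \<le> norm x" for \<omega>'
      using k by (auto simp: g_def intro!: mult_left_le_one_le)
    have "continuous_on UNIV g"
      unfolding g_def using k by (intro continuous_intros) auto
    then have "g \<in> bcontfun" by (rule bcontfun_normI) (rule b)
    then obtain h where h: "\<And>\<omega>'. apply_bcontfun h \<omega>' = g \<omega>'"
      by (metis Bcontfun_inverse)
    have "norm (g \<omega>') \<le> norm x / k * norm (apply_bcontfun f \<omega>')" for \<omega>'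
    proof -
      have "norm (g \<omega>') = min 1 (norm (apply_bcontfun f \<omega>') / k) * norm x"
        using k by (simp add: g_def)
      also have "\<dots> \<le> (norm (apply_bcontfun f \<omega>') / k) * norm x"
        by (intro mult_right_mono) auto
      finally show ?thesis by (simp add: mult.commute)
    qed
    then have "h \<in> Z"
      using Z(1) f(1) h unfolding solid_subspace_def by metis
    moreover have "apply_bcontfun h \<omega> = x" using k by (simp add: h g_def k_def)
    moreover have "norm h \<le> norm x" by (rule norm_bound) (simp add: h b)
    ultimately show "\<exists>f\<in>Z. apply_bcontfun f \<omega> = x \<and> norm f \<le> norm x" by blast
  qed
qed

lemma approx_conormal_from_solid_subspace:
  fixes P :: "'a::real_normed_vector set" and Z :: "('b::topological_space \<Rightarrow>\<^sub>C 'a) set"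
  assumes \<alpha>: "\<alpha> > 0" and Z: "solid_subspace Z" "Z \<noteq> {0}"
    and ac: "approx_conormal \<alpha> Z (pos_part Z P)"
  shows "approx_conormal \<alpha> UNIV P"
  unfolding approx_conormal_def conormal_def
proof (intro allI impI ballI)
  fix \<epsilon> :: real and x assume \<epsilon>: "\<epsilon> > 0"
  obtain \<omega> where "\<And>x. \<exists>f\<in>Z. apply_bcontfun f \<omega> = x \<and> norm f \<le> norm x"
    using solid_subspace_attains[OF Z] by blast
  then obtain f where f: "f \<in> Z" "apply_bcontfun f \<omega> = x" "norm f \<le> norm x" by blast
  obtain u v where uv: "u \<in> pos_part Z P" "v \<in> pos_part Z P" "f = u - v" "norm u \<le> (\<alpha> + \<epsilon>) * norm f"
    using ac \<epsilon> f(1) unfolding approx_conormal_def conormal_def by blast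
  have "norm (apply_bcontfun u \<omega>) \<le> (\<alpha> + \<epsilon>) * norm x"
    using norm_bounded[of u \<omega>] uv(4) mult_left_mono[OF f(3), of "\<alpha> + \<epsilon>"] \<alpha> \<epsilon> by linarith
  then show "\<exists>zp\<in>P. \<exists>zn\<in>P. x = zp - zn \<and> norm zp \<le> (\<alpha> + \<epsilon>) * norm x"
    using uv(1-3) f(2)
    by (intro bexI[of _ "apply_bcontfun u \<omega>"] bexI[of _ "apply_bcontfun v \<omega>"]) (auto simp: pos_part_def)
qed

theorem corollary4p9:
  fixes P :: "'a::banach set" and \<alpha> :: real
  assumes "convex_cone P" and "closed P" and "generating P" and "\<alpha> > 0"
  shows "(approx_conormal \<alpha> (UNIV :: 'a set) P \<longrightarrow>
            approx_conormal \<alpha> (Cb :: ('b::topological_space \<Rightarrow>\<^sub>C 'a) set) (pos_part Cb P) \<and>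
            approx_conormal \<alpha> (C0 :: ('b \<Rightarrow>\<^sub>C 'a) set) (pos_part C0 P) \<and>
            approx_conormal \<alpha> (Cc :: ('b \<Rightarrow>\<^sub>C 'a) set) (pos_part Cc P))
       \<and> ((Cb :: ('b \<Rightarrow>\<^sub>C 'a) set) \<noteq> {0} \<and>
            approx_conormal \<alpha> (Cb :: ('b \<Rightarrow>\<^sub>C 'a) set) (pos_part Cb P) \<longrightarrow>
            approx_conormal \<alpha> (UNIV :: 'a set) P)
       \<and> ((C0 :: ('b \<Rightarrow>\<^sub>C 'a) set) \<noteq> {0} \<and>
            approx_conormal \<alpha> (C0 :: ('b \<Rightarrow>\<^sub>C 'a) set) (pos_part C0 P) \<longrightarrow>
            approx_conormal \<alpha> (UNIV :: 'a set) P)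
       \<and> ((Cc :: ('b \<Rightarrow>\<^sub>C 'a) set) \<noteq> {0} \<and>
            approx_conormal \<alpha> (Cc :: ('b \<Rightarrow>\<^sub>C 'a) set) (pos_part Cc P) \<longrightarrow>
            approx_conormal \<alpha> (UNIV :: 'a set) P)"
proof -
  have both: "(approx_conormal \<alpha> UNIV P \<longrightarrow> approx_conormal \<alpha> Z (pos_part Z P)) \<and>
      (Z \<noteq> {0} \<and> approx_conormal \<alpha> Z (pos_part Z P) \<longrightarrow> approx_conormal \<alpha> UNIV P)"
    if "solid_subspace Z" for Z :: "('b \<Rightarrow>\<^sub>C 'a) set"
  proof (intro conjI impI)
    show "approx_conormal \<alpha> Z (pos_part Z P)" if "approx_conormal \<alpha> UNIV P"
      by (rule approx_conormal_solid_subspace[OF assms(1,2,4) \<open>solid_subspace Z\<close> that])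
    show "approx_conormal \<alpha> UNIV P" if "Z \<noteq> {0} \<and> approx_conormal \<alpha> Z (pos_part Z P)"
      using approx_conormal_from_solid_subspace[OF assms(4) \<open>solid_subspace Z\<close>] that by simp
  qed
  show ?thesis
    using both[OF solid_subspace_Cb] both[OF solid_subspace_C0] both[OF solid_subspace_Cc]
    by argo
qed

end
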